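(* Let $G$ and $H$ be finite, simple, connected graphs. Then $\dim_f(G\Box H)\leq \max\{\dim_f(G),|V(H)|\}$.
   Context: The cartesian product $G\Box H$ has vertex set $V(G)\times V(H)$, with $(u_1,v_1)$ adjacent to $(u_2,v_2)$ iff either $u_1=u_2$ and $v_1v_2\in E(H)$, or $v_1=v_2$ and $u_1u_2\in E(G)$. For vertices $x,y$ of a connected graph $G$, $R\{x,y\}$ is the set of $z$ with $d(x,z)\neq d(y,z)$. A resolving function of $G$ is $f:V(G)\to[0,1]$ with $\sum_{z\in R\{x,y\}}f(z)\geq 1$ for all distinct $x,y$; $\dim_f(G)$ is the minimum of $\sum_{v\in V(G)}f(v)$ over all resolving functions. *)

theory Defs
  imports "HOL-Analysis.Analysis" "Graph_Theory.Graph_Theory"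
begin

text \<open>A finite simple graph is a \<^locale>\<open>pair_graph\<close>: a finite vertex set together with a symmetric
  and irreflexive set of ordered pairs of vertices, so that an edge $uv$ is represented by the two
  arcs $(u,v)$ and $(v,u)$.\<close>

definition cartesian_product ::
  "'a pair_pre_digraph \<Rightarrow> 'b pair_pre_digraph \<Rightarrow> ('a \<times> 'b) pair_pre_digraph" (infixr "\<box>" 80) where
  "G \<box> H =
     \<lparr> pverts = pverts G \<times> pverts H,
       parcs = {((u1, v1), (u2, v2)) | u1 v1 u2 v2.
         u1 \<in> pverts G \<and> u2 \<in> pverts G \<and> v1 \<in> pverts H \<and> v2 \<in> pverts H \<and>
         (u1 = u2 \<and> (v1, v2) \<in> parcs H \<or> v1 = v2 \<and> (u1, u2) \<in> parcs G)} \<rparr>"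

text \<open>The usual distance: the infimum of the lengths of walks, as every arc has cost 1.  It is
  extended real valued because \<open>\<mu>\<close> is, and finite on connected graphs.\<close>

definition graph_dist :: "'a pair_pre_digraph \<Rightarrow> 'a \<Rightarrow> 'a \<Rightarrow> ereal" where
  "graph_dist G x y = wf_digraph.\<mu> (with_proj G) (\<lambda>_. 1) x y"

definition resolving_set :: "'a pair_pre_digraph \<Rightarrow> 'a \<Rightarrow> 'a \<Rightarrow> 'a set" where
  "resolving_set G x y = {z \<in> pverts G. graph_dist G x z \<noteq> graph_dist G y z}"

text \<open>Only the values of \<open>f\<close> on the vertices matter here and below.\<close>

definition resolving_function :: "'a pair_pre_digraph \<Rightarrow> ('a \<Rightarrow> real) \<Rightarrow> bool" where
  "resolving_function G f \<longleftrightarrow>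
     (\<forall>v \<in> pverts G. f v \<in> {0..1}) \<and>
     (\<forall>x \<in> pverts G. \<forall>y \<in> pverts G. x \<noteq> y \<longrightarrow> (\<Sum>z \<in> resolving_set G x y. f z) \<ge> 1)"

text \<open>\<open>LEAST\<close> on the reals denotes the minimum only if it is attained; this is shown for finite
  graphs in \<open>frac_metric_dim_attained\<close> and \<open>frac_metric_dim_le\<close> below.\<close>

definition frac_metric_dim :: "'a pair_pre_digraph \<Rightarrow> real" where
  "frac_metric_dim G = (LEAST s. \<exists>f. resolving_function G f \<and> s = (\<Sum>v \<in> pverts G. f v))"

lemma pair_graph_cartesian_product:
  assumes "pair_graph G" "pair_graph H"
  shows "pair_graph (G \<box> H)"
proof -
  interpret G: pair_graph G by fact
  interpret H: pair_graph H by fact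
  have sub: "parcs (G \<box> H) \<subseteq> (pverts G \<times> pverts H) \<times> (pverts G \<times> pverts H)"
    by (auto simp: cartesian_product_def)
  have symG: "(b, a) \<in> parcs G" if "(a, b) \<in> parcs G" for a b
    using G.pair_sym_arcs that by (simp add: symmetric_def sym_def)
  have symH: "(b, a) \<in> parcs H" if "(a, b) \<in> parcs H" for a b
    using H.pair_sym_arcs that by (simp add: symmetric_def sym_def)
  show ?thesis
  proof
    show "finite (pverts (G \<box> H))"
      by (simp add: cartesian_product_def G.pair_finite_verts H.pair_finite_verts)
    show "finite (parcs (G \<box> H))"
      by (rule finite_subset[OF sub]) (simp add: G.pair_finite_verts H.pair_finite_verts)
    show "symmetric (with_proj (G \<box> H))"
      using symG symH by (auto simp: symmetric_def sym_def cartesian_product_def)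
  qed (auto simp: cartesian_product_def dest: G.no_loops' H.no_loops')
qed

lemma resolving_function_one:
  assumes "pair_graph G"
  shows "resolving_function G (\<lambda>_. 1)"
proof -
  interpret pair_graph G by fact
  have self: "graph_dist G x x = 0" if "x \<in> pverts G" for x
  proof (rule antisym)
    have "awalk x [] x" using that by (simp add: awalk_Nil_iff)
    from min_cost_le_walk_cost[OF this, of "\<lambda>_. 1"] show "graph_dist G x x \<le> 0"
      by (simp add: graph_dist_def zero_ereal_def)
    show "0 \<le> graph_dist G x x"
      unfolding graph_dist_def \<mu>_def
      by (rule INF_greatest) (auto intro!: pos_cost_pos_awalk_cost)
  qed
  have other: "graph_dist G y x \<noteq> 0" if "x \<noteq> y" for x y
  proof -
    have "1 \<le> graph_dist G y x"
      unfolding graph_dist_def \<mu>_def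
    proof (rule INF_greatest)
      fix p assume "p \<in> {p. awalk y p x}"
      then have "length p \<noteq> 0" using that by (auto simp: awalk_Nil_iff)
      moreover have "awalk_cost (\<lambda>_. 1) p = real (length p)"
        by (induct p) auto
      ultimately show "1 \<le> ereal (awalk_cost (\<lambda>_. 1) p)"
        by (cases p) (auto simp: one_ereal_def)
    qed
    then show ?thesis by auto
  qed
  have "1 \<le> (\<Sum>z \<in> resolving_set G x y. 1 :: real)"
    if "x \<in> pverts G" "y \<in> pverts G" "x \<noteq> y" for x y
  proof -
    have "x \<in> resolving_set G x y"
      using that self other[of x y] by (auto simp: resolving_set_def)
    moreover have "finite (resolving_set G x y)"
      by (simp add: resolving_set_def pair_finite_verts)
    ultimately have "card (resolving_set G x y) \<noteq> 0" by auto
    then show ?thesis by simp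
  qed
  then show ?thesis by (auto simp: resolving_function_def)
qed

lemma minimum_resolving_function:
  assumes "pair_graph G"
  obtains f where "resolving_function G f"
    and "\<And>g. resolving_function G g \<Longrightarrow> (\<Sum>v \<in> pverts G. f v) \<le> (\<Sum>v \<in> pverts G. g v)"
proof -
  interpret pair_graph G by fact
  define V where "V = pverts G"
  define B where "B v = (if v \<in> V then {0..1} else {0 :: real})" for v
  define C where "C = {f. \<forall>x \<in> V. \<forall>y \<in> V. x \<noteq> y \<longrightarrow> 1 \<le> (\<Sum>z \<in> resolving_set G x y. f z :: real)}"
  define r where "r g v = (if v \<in> V then g v else 0 :: real)" for g v
  have cont: "continuous_on UNIV (\<lambda>f :: 'a \<Rightarrow> real. \<Sum>z \<in> A. f z)" for A
    by (intro continuous_intros continuous_on_product_coordinates)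
  have "compactin (product_topology (\<lambda>_. euclidean) UNIV) (PiE UNIV B)"
    by (subst compactin_PiE) (auto simp: B_def)
  then have "compact (PiE UNIV B)"
    by (simp add: euclidean_product_topology)
  moreover have "closed C"
    unfolding C_def Ball_def imp_conv_disj
    by (intro closed_Collect_all closed_Collect_disj closed_Collect_const closed_Collect_le
        continuous_on_const cont)
  ultimately have comp: "compact (PiE UNIV B \<inter> C)"
    by (rule compact_Int_closed)
  have r_in: "r g \<in> PiE UNIV B \<inter> C" if "resolving_function G g" for g
  proof -
    have "(\<Sum>z \<in> resolving_set G x y. r g z) = (\<Sum>z \<in> resolving_set G x y. g z)" for x y
      by (rule sum.cong) (auto simp: r_def V_def resolving_set_def)
    then show ?thesis
      using that by (auto simp: resolving_function_def B_def C_def r_def V_def)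
  qed
  have "PiE UNIV B \<inter> C \<noteq> {}"
    using r_in[OF resolving_function_one[OF assms]] by blast
  from continuous_attains_inf[OF comp this continuous_on_subset[OF cont subset_UNIV], of V]
  obtain f where f: "f \<in> PiE UNIV B \<inter> C"
    and min: "\<And>g. g \<in> PiE UNIV B \<inter> C \<Longrightarrow> (\<Sum>v \<in> V. f v) \<le> (\<Sum>v \<in> V. g v)"
    by blast
  show thesis
  proof (rule that)
    have "f v \<in> {0..1}" if "v \<in> pverts G" for v
    proof -
      have "f v \<in> B v" using f by auto
      then show ?thesis using that by (simp add: B_def V_def)
    qed
    then show "resolving_function G f"
      using f by (auto simp: resolving_function_def C_def V_def)
    fix g assume "resolving_function G g"
    from min[OF r_in[OF this]]
    have "(\<Sum>v \<in> V. f v) \<le> (\<Sum>v \<in> V. r g v)" .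
    also have "\<dots> = (\<Sum>v \<in> V. g v)"
      by (rule sum.cong) (auto simp: r_def)
    finally show "(\<Sum>v \<in> pverts G. f v) \<le> (\<Sum>v \<in> pverts G. g v)"
      by (simp add: V_def)
  qed
qed

lemma frac_metric_dim_attained:
  assumes "pair_graph G"
  shows "\<exists>f. resolving_function G f \<and> frac_metric_dim G = (\<Sum>v \<in> pverts G. f v)"
proof -
  obtain f where f: "resolving_function G f"
    and min: "\<And>g. resolving_function G g \<Longrightarrow> (\<Sum>v \<in> pverts G. f v) \<le> (\<Sum>v \<in> pverts G. g v)"
    using minimum_resolving_function[OF assms] by blast
  have "frac_metric_dim G = (\<Sum>v \<in> pverts G. f v)"
    unfolding frac_metric_dim_def using f min by (intro Least_equality) auto
  with f show ?thesis by blast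
qed

lemma frac_metric_dim_le:
  assumes "pair_graph G" "resolving_function G g"
  shows "frac_metric_dim G \<le> (\<Sum>v \<in> pverts G. g v)"
proof -
  obtain f where f: "resolving_function G f"
    and min: "\<And>g. resolving_function G g \<Longrightarrow> (\<Sum>v \<in> pverts G. f v) \<le> (\<Sum>v \<in> pverts G. g v)"
    using minimum_resolving_function[OF assms(1)] by blast
  have "frac_metric_dim G = (\<Sum>v \<in> pverts G. f v)"
    unfolding frac_metric_dim_def using f min by (intro Least_equality) auto
  with min[OF assms(2)] show ?thesis by simp
qed

end

theory Submission
  imports Defs
begin

text \<open>Take an optimal resolving function \<open>g\<close> of \<open>G\<close> with total weight \<open>s > 0\<close>, put \<open>n = |V(H)|\<close>, and
  spread it over the product by \<open>f (u, v) = g u / min s n\<close>; its total weight is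
  \<open>s * n / min s n = max s n\<close>.  A pair that agrees in the \<open>H\<close>-coordinate is resolved by
  \<open>R \<times> V(H)\<close> with \<open>R\<close> a resolving set of \<open>G\<close>, whose weight is at least \<open>n / min s n\<close>.  For a pair
  \<open>(u1, v1)\<close>, \<open>(u2, v2)\<close> with \<open>v1 \<noteq> v2\<close> and any vertex \<open>u\<close> of \<open>G\<close>, at least one of \<open>(u, v1)\<close> and
  \<open>(u, v2)\<close> resolves it: otherwise \<open>d(u1, u) - d(u2, u)\<close> would equal both \<open>d(v1, v2)\<close> and
  \<open>- d(v1, v2)\<close>.  Hence its resolving set has weight at least \<open>s / min s n\<close>.  If \<open>s = 0\<close>, then \<open>G\<close>
  is a single vertex and the constant function 1 has weight \<open>n\<close>.\<close>

section \<open>Distances as lengths of shortest walks\<close>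

lemma graph_dist_eqI:
  assumes "pair_graph G" and p: "pre_digraph.awalk (with_proj G) x p y"
    and min: "\<And>q. pre_digraph.awalk (with_proj G) x q y \<Longrightarrow> length p \<le> length q"
  shows "graph_dist G x y = ereal (real (length p))"
proof -
  interpret pair_graph G by fact
  have cost: "awalk_cost (\<lambda>_. 1) q = real (length q)" for q
    by (induct q) auto
  show ?thesis
    unfolding graph_dist_def \<mu>_def cost
  proof (rule INF_eqI)
    show "ereal (real (length p)) \<le> ereal (real (length q))" if "q \<in> {q. awalk x q y}" for q
      using min that by simp
    show "c \<le> ereal (real (length p))"
      if "\<And>q. q \<in> {q. awalk x q y} \<Longrightarrow> c \<le> ereal (real (length q))" for c
      using that p by simp
  qed
qed

text \<open>The arcs are symmetric, so connectedness yields a directed walk, and lengths in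
  \<open>nat\<close> have a least one. Distances thus become finite naturals, which makes
  cancellation in \<open>ereal\<close> sound.\<close>

lemma graph_dist_attained:
  assumes G: "pair_graph G" "Digraph_Component.connected (with_proj G)"
    and xy: "x \<in> pverts G" "y \<in> pverts G"
  obtains p where "pre_digraph.awalk (with_proj G) x p y"
    and "graph_dist G x y = ereal (real (length p))"
    and "\<And>q. pre_digraph.awalk (with_proj G) x q y \<Longrightarrow> length p \<le> length q"
proof -
  interpret pair_graph G by fact
  have "strongly_connected (with_proj G)"
    using symmetric_connected_imp_strongly_connected[OF pair_sym_arcs G(2)] .
  then have "\<exists>p. awalk x p y"
    using xy by (auto simp: strongly_connected_def reachable_awalk[symmetric])
  from ex_has_least_nat[where P = "\<lambda>p. awalk x p y" and m = length, OF someI_ex[OF this]]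
  obtain p where p: "awalk x p y" and min: "\<And>q. awalk x q y \<Longrightarrow> length p \<le> length q"
    by blast
  have "graph_dist G x y = ereal (real (length p))"
    using graph_dist_eqI[OF G(1) p min] .
  with p min show thesis using that by blast
qed

lemma graph_dist_eq_0_iff:
  assumes "pair_graph G" "Digraph_Component.connected (with_proj G)"
    and "x \<in> pverts G" "y \<in> pverts G"
  shows "graph_dist G x y = 0 \<longleftrightarrow> x = y"
proof -
  interpret pair_graph G by fact
  obtain p where p: "awalk x p y" "graph_dist G x y = ereal (real (length p))"
    and min: "\<And>q. awalk x q y \<Longrightarrow> length p \<le> length q"
    using graph_dist_attained[OF assms] by blast
  show ?thesis
    \<comment> \<open>For \<open>x = y\<close> the empty walk competes with \<open>p\<close>;
      conversely a walk of length 0 does not leave \<open>x\<close>.\<close>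
    using p min[of "[]"] \<open>x \<in> pverts G\<close> by (auto simp: awalk_Nil_iff)
qed

section \<open>Walks and distances in the product\<close>

lemma pverts_cartesian_product: "pverts (G \<box> H) = pverts G \<times> pverts H"
  by (simp add: cartesian_product_def)

text \<open>Each arc of the product moves along an arc of one factor and fixes the other coordinate,
  so it is charged to exactly one of \<open>q\<close> and \<open>r\<close>. This gives the lower
  bound on product distances.\<close>

lemma awalk_cartesian_product_project:
  assumes "pair_graph G" "pair_graph H" "pre_digraph.awalk (with_proj (G \<box> H)) x p y"
  shows "\<exists>q r. pre_digraph.awalk (with_proj G) (fst x) q (fst y)
    \<and> pre_digraph.awalk (with_proj H) (snd x) r (snd y) \<and> length p = length q + length r"
proof -
  interpret G: pair_graph G by fact
  interpret H: pair_graph H by fact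
  interpret P: pair_graph "G \<box> H"
    using assms(1,2) by (rule pair_graph_cartesian_product)
  show ?thesis
    using assms(3)
  proof (induct p arbitrary: x)
    case Nil
    then have "G.awalk (fst x) [] (fst y)" "H.awalk (snd x) [] (snd y)"
      by (auto simp: P.awalk_Nil_iff G.awalk_Nil_iff H.awalk_Nil_iff pverts_cartesian_product)
    then show ?case
      by (metis add.right_neutral list.size(3))
  next
    case (Cons e p)
    then have e: "e \<in> parcs (G \<box> H)" "fst e = x" and "P.awalk (snd e) p y"
      by (auto simp: P.awalk_Cons_iff)
    from Cons.hyps[OF this(3)] obtain q r where q: "G.awalk (fst (snd e)) q (fst y)"
      and r: "H.awalk (snd (snd e)) r (snd y)" and len: "length p = length q + length r"
      by blast
    from e consider
        "fst x = fst (snd e)" "(snd x, snd (snd e)) \<in> parcs H"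
      | "snd x = snd (snd e)" "(fst x, fst (snd e)) \<in> parcs G"
      by (auto simp: cartesian_product_def)
    then show ?case
    proof cases
      case 1
      then have "H.awalk (snd x) ((snd x, snd (snd e)) # r) (snd y)"
        using r by (simp add: H.awalk_Cons_iff)
      moreover have "length (e # p) = length q + length ((snd x, snd (snd e)) # r)"
        using len by simp
      ultimately show ?thesis using 1 q by metis
    next
      case 2
      then have "G.awalk (fst x) ((fst x, fst (snd e)) # q) (fst y)"
        using q by (simp add: G.awalk_Cons_iff)
      moreover have "length (e # p) = length ((fst x, fst (snd e)) # q) + length r"
        using len by simp
      ultimately show ?thesis using 2 r by metis
    qed
  qed
qed

lemma awalk_cartesian_product_left:
  assumes "pair_graph G" "pair_graph H" "v \<in> pverts H" "pre_digraph.awalk (with_proj G) a p b"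
  shows "pre_digraph.awalk (with_proj (G \<box> H)) (a, v) (map (\<lambda>e. ((fst e, v), (snd e, v))) p) (b, v)"
proof -
  interpret G: pair_graph G by fact
  interpret P: pair_graph "G \<box> H"
    using assms(1,2) by (rule pair_graph_cartesian_product)
  show ?thesis
    using assms(4)
  proof (induct p arbitrary: a)
    case Nil
    then show ?case
      using assms(3) by (auto simp: P.awalk_Nil_iff G.awalk_Nil_iff pverts_cartesian_product)
  next
    case (Cons e p)
    then have "((fst e, v), (snd e, v)) \<in> parcs (G \<box> H)"
      using assms(3) by (auto simp: G.awalk_Cons_iff cartesian_product_def dest: G.wellformed')
    with Cons show ?case by (auto simp: P.awalk_Cons_iff G.awalk_Cons_iff)
  qed
qed

lemma awalk_cartesian_product_right:
  assumes "pair_graph G" "pair_graph H" "u \<in> pverts G" "pre_digraph.awalk (with_proj H) a p b"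
  shows "pre_digraph.awalk (with_proj (G \<box> H)) (u, a) (map (\<lambda>e. ((u, fst e), (u, snd e))) p) (u, b)"
proof -
  interpret H: pair_graph H by fact
  interpret P: pair_graph "G \<box> H"
    using assms(1,2) by (rule pair_graph_cartesian_product)
  show ?thesis
    using assms(4)
  proof (induct p arbitrary: a)
    case Nil
    then show ?case
      using assms(3) by (auto simp: P.awalk_Nil_iff H.awalk_Nil_iff pverts_cartesian_product)
  next
    case (Cons e p)
    then have "((u, fst e), (u, snd e)) \<in> parcs (G \<box> H)"
      using assms(3) by (auto simp: H.awalk_Cons_iff cartesian_product_def dest: H.wellformed')
    with Cons show ?case by (auto simp: P.awalk_Cons_iff H.awalk_Cons_iff)
  qed
qed

lemma graph_dist_cartesian_product:
  assumes G: "pair_graph G" "Digraph_Component.connected (with_proj G)"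
    and H: "pair_graph H" "Digraph_Component.connected (with_proj H)"
    and u: "u1 \<in> pverts G" "u2 \<in> pverts G" and v: "v1 \<in> pverts H" "v2 \<in> pverts H"
  shows "graph_dist (G \<box> H) (u1, v1) (u2, v2) = graph_dist G u1 u2 + graph_dist H v1 v2"
proof -
  interpret G: pair_graph G by fact
  interpret H: pair_graph H by fact
  interpret P: pair_graph "G \<box> H"
    using G(1) H(1) by (rule pair_graph_cartesian_product)
  obtain q where q: "G.awalk u1 q u2" "graph_dist G u1 u2 = ereal (real (length q))"
    and minq: "\<And>p. G.awalk u1 p u2 \<Longrightarrow> length q \<le> length p"
    using graph_dist_attained[OF G u] by blast
  obtain r where r: "H.awalk v1 r v2" "graph_dist H v1 v2 = ereal (real (length r))"
    and minr: "\<And>p. H.awalk v1 p v2 \<Longrightarrow> length r \<le> length p"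
    using graph_dist_attained[OF H v] by blast
  \<comment> \<open>A shortest walk of \<open>G\<close> inside the copy at \<open>v1\<close>, then a
    shortest walk of \<open>H\<close> inside the copy at \<open>u2\<close>; projecting any
    competitor shows that none is shorter.\<close>
  define p where "p = map (\<lambda>e. ((fst e, v1), (snd e, v1))) q @ map (\<lambda>e. ((u2, fst e), (u2, snd e))) r"
  have "P.awalk (u1, v1) p (u2, v2)"
    unfolding p_def
    using awalk_cartesian_product_left[OF G(1) H(1) v(1) q(1)]
      awalk_cartesian_product_right[OF G(1) H(1) u(2) r(1)] by (rule P.awalk_appendI)
  moreover have len: "length p = length q + length r"
    by (simp add: p_def)
  moreover have "length p \<le> length p'" if p': "P.awalk (u1, v1) p' (u2, v2)" for p'
  proof -
    obtain q' r' where "G.awalk u1 q' u2" "H.awalk v1 r' v2" "length p' = length q' + length r'"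
      using awalk_cartesian_product_project[OF G(1) H(1) p'] by auto
    then show ?thesis
      using minq[of q'] minr[of r'] len by simp
  qed
  ultimately have "graph_dist (G \<box> H) (u1, v1) (u2, v2) = ereal (real (length q + length r))"
    using graph_dist_eqI[OF P.pair_graph_axioms] by metis
  then show ?thesis
    using q(2) r(2) by simp
qed

section \<open>Resolving sets of the product\<close>

text \<open>Both distances to \<open>(a, b)\<close> contain the same finite summand
  \<open>graph_dist H v b\<close>, which cancels.\<close>

lemma resolving_set_cartesian_product_same_snd:
  assumes G: "pair_graph G" "Digraph_Component.connected (with_proj G)"
    and H: "pair_graph H" "Digraph_Component.connected (with_proj H)"
    and u: "u1 \<in> pverts G" "u2 \<in> pverts G" and v: "v \<in> pverts H"
  shows "resolving_set (G \<box> H) (u1, v) (u2, v) = resolving_set G u1 u2 \<times> pverts H"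
proof -
  have "graph_dist (G \<box> H) (u1, v) (a, b) = graph_dist (G \<box> H) (u2, v) (a, b)
      \<longleftrightarrow> graph_dist G u1 a = graph_dist G u2 a"
    if a: "a \<in> pverts G" and b: "b \<in> pverts H" for a b
  proof -
    obtain k where "graph_dist G u1 a = ereal (real k)"
      using graph_dist_attained[OF G u(1) a] by blast
    moreover obtain l where "graph_dist G u2 a = ereal (real l)"
      using graph_dist_attained[OF G u(2) a] by blast
    moreover obtain m where "graph_dist H v b = ereal (real m)"
      using graph_dist_attained[OF H v b] by blast
    ultimately show ?thesis
      using graph_dist_cartesian_product[OF G H u(1) a v b]
        graph_dist_cartesian_product[OF G H u(2) a v b] by simp
  qed
  then show ?thesis
    by (auto simp: resolving_set_def pverts_cartesian_product)
qed

text \<open>With \<open>a\<close>, \<open>b\<close>, \<open>c\<close>, \<open>d\<close> as in the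
  proof, failure at \<open>(u, v1)\<close> means \<open>a = b + d\<close> and failure at
  \<open>(u, v2)\<close> means \<open>a + c = b\<close>. Together they force
  \<open>c + d = 0\<close>, contrary to \<open>v1 \<noteq> v2\<close>.\<close>

lemma resolving_set_cartesian_product_column:
  assumes G: "pair_graph G" "Digraph_Component.connected (with_proj G)"
    and H: "pair_graph H" "Digraph_Component.connected (with_proj H)"
    and u: "u1 \<in> pverts G" "u2 \<in> pverts G" "u \<in> pverts G"
    and v: "v1 \<in> pverts H" "v2 \<in> pverts H" "v1 \<noteq> v2"
  shows "(u, v1) \<in> resolving_set (G \<box> H) (u1, v1) (u2, v2)
    \<or> (u, v2) \<in> resolving_set (G \<box> H) (u1, v1) (u2, v2)"
proof -
  obtain a where a: "graph_dist G u1 u = ereal (real a)"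
    using graph_dist_attained[OF G u(1,3)] by blast
  obtain b where b: "graph_dist G u2 u = ereal (real b)"
    using graph_dist_attained[OF G u(2,3)] by blast
  obtain c where c: "graph_dist H v1 v2 = ereal (real c)"
    using graph_dist_attained[OF H v(1,2)] by blast
  obtain d where d: "graph_dist H v2 v1 = ereal (real d)"
    using graph_dist_attained[OF H v(2,1)] by blast
  have "graph_dist H v1 v1 = 0" "graph_dist H v2 v2 = 0" "graph_dist H v1 v2 \<noteq> 0"
    using v by (simp_all add: graph_dist_eq_0_iff[OF H])
  then show ?thesis
    using a b c d u v
    by (auto simp: resolving_set_def pverts_cartesian_product graph_dist_cartesian_product[OF G H])
qed

section \<open>A rescaled resolving function on the product\<close>

theorem theorem4p2:
  fixes G :: "'a pair_pre_digraph" and H :: "'b pair_pre_digraph"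
  assumes "pair_graph G" and "Digraph_Component.connected (with_proj G)"
    and "pair_graph H" and "Digraph_Component.connected (with_proj H)"
  shows "frac_metric_dim (G \<box> H) \<le> max (frac_metric_dim G) (real (card (pverts H)))"
proof -
  note G = assms(1,2) and H = assms(3,4)
  interpret G: pair_graph G by fact
  interpret H: pair_graph H by fact
  have P: "pair_graph (G \<box> H)"
    using G(1) H(1) by (rule pair_graph_cartesian_product)
  obtain g where g: "resolving_function G g" and dim: "frac_metric_dim G = (\<Sum>v \<in> pverts G. g v)"
    using frac_metric_dim_attained[OF G(1)] by blast
  define s where "s = (\<Sum>v \<in> pverts G. g v)"
  define n where "n = real (card (pverts H))"
  have g01: "0 \<le> g v" "g v \<le> 1" if "v \<in> pverts G" for v
    using g that by (auto simp: resolving_function_def)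
  have gR: "1 \<le> (\<Sum>z \<in> resolving_set G x y. g z)"
    if "x \<in> pverts G" "y \<in> pverts G" "x \<noteq> y" for x y
    using g that by (auto simp: resolving_function_def)
  have g_le: "g v \<le> s" if "v \<in> pverts G" for v
    unfolding s_def using that g01 by (intro member_le_sum G.pair_finite_verts) auto
  have "0 \<le> s"
    unfolding s_def using g01 by (intro sum_nonneg) auto
  \<comment> \<open>Having a vertex is part of the definition of
    \<open>strongly_connected\<close>.\<close>
  have "pverts H \<noteq> {}"
    using H(2) by (auto simp: connected_def strongly_connected_def)
  then have "1 \<le> n"
    using H.pair_finite_verts by (simp add: n_def Suc_le_eq card_gt_0_iff)
  show ?thesis
  proof (cases "s = 0")
    case True
    \<comment> \<open>Two distinct vertices would have a resolving set of weight at least 1 inside a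
      total weight of 0.\<close>
    have "x = y" if "x \<in> pverts G" "y \<in> pverts G" for x y
    proof (rule ccontr)
      assume "x \<noteq> y"
      from gR[OF that this] have "1 \<le> (\<Sum>z \<in> resolving_set G x y. g z)" .
      also have "\<dots> \<le> s"
        unfolding s_def using g01
        by (intro sum_mono2 G.pair_finite_verts) (auto simp: resolving_set_def)
      finally show False using True by simp
    qed
    then have "card (pverts G) \<le> 1"
      by (auto simp: card_le_Suc0_iff_eq[OF G.pair_finite_verts])
    then have "card (pverts G) * card (pverts H) \<le> card (pverts H)"
      using mult_le_mono1 by fastforce
    then have "real (card (pverts G \<times> pverts H)) \<le> n"
      by (simp add: n_def card_cartesian_product flip: of_nat_mult)
    then show ?thesis
      using frac_metric_dim_le[OF P resolving_function_one[OF P]] by (simp add: pverts_cartesian_product n_def)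
  next
    case False
    define m where "m = min s n"
    have m: "0 < m" "m \<le> s" "m \<le> n"
      using False \<open>0 \<le> s\<close> \<open>1 \<le> n\<close> by (auto simp: m_def)
    define f where "f = (\<lambda>z :: 'a \<times> 'b. g (fst z) / m)"
    have f01: "0 \<le> f z" "f z \<le> 1" if "z \<in> pverts G \<times> pverts H" for z
    proof -
      have z: "fst z \<in> pverts G" using that by auto
      show "0 \<le> f z" using g01[OF z] m by (simp add: f_def)
      \<comment> \<open>A single value of \<open>g\<close> is at most the sum \<open>s\<close>, and
        at most \<open>1 \<le> n\<close>; hence dividing by \<open>m\<close> stays within the unit
        interval.\<close>
      have "g (fst z) \<le> m"
        using g01[OF z] g_le[OF z] \<open>1 \<le> n\<close> by (simp add: m_def)
      then show "f z \<le> 1" using m by (simp add: f_def)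
    qed
    \<comment> \<open>Used with \<open>A\<close> a resolving set of \<open>G\<close> and, for the
      total weight, with \<open>A = pverts G\<close>.\<close>
    have times: "(\<Sum>z \<in> A \<times> pverts H. f z) = (\<Sum>u \<in> A. g u) * n / m" for A
    proof -
      have "(\<Sum>z \<in> A \<times> pverts H. f z) = (\<Sum>u \<in> A. \<Sum>v \<in> pverts H. g u / m)"
        by (simp only: f_def sum.cartesian_product case_prod_unfold)
      also have "\<dots> = (\<Sum>u \<in> A. g u) * n / m"
        by (simp add: n_def sum_distrib_right sum_divide_distrib mult.commute)
      finally show ?thesis .
    qed
    have "1 \<le> (\<Sum>z \<in> resolving_set (G \<box> H) (u1, v1) (u2, v2). f z)"
      if u: "u1 \<in> pverts G" "u2 \<in> pverts G" and v: "v1 \<in> pverts H" "v2 \<in> pverts H"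
        and ne: "(u1, v1) \<noteq> (u2, v2)" for u1 v1 u2 v2
    proof (cases "v1 = v2")
      case True
      then have "1 \<le> (\<Sum>z \<in> resolving_set G u1 u2. g z)"
        using gR u ne by blast
      then have "m \<le> (\<Sum>z \<in> resolving_set G u1 u2. g z) * n"
        using mult_mono[of 1 "\<Sum>z \<in> resolving_set G u1 u2. g z" m n] m by simp
      then show ?thesis
        using m by (simp add: resolving_set_cartesian_product_same_snd[OF G H u v(1)] times
          flip: True)
    next
      case False
      let ?R = "resolving_set (G \<box> H) (u1, v1) (u2, v2)"
      \<comment> \<open>\<open>c\<close> selects one resolving vertex over each \<open>u\<close>.
        Since \<open>u\<close> can be read off from \<open>(u, c u)\<close>, these vertices are
        distinct and carry total weight \<open>s / m\<close>.\<close>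
      define c where "c u = (if (u, v1) \<in> ?R then v1 else v2)" for u
      have "(u, c u) \<in> ?R" if "u \<in> pverts G" for u
        using resolving_set_cartesian_product_column[OF G H u that v False] by (auto simp: c_def)
      then have sub: "(\<lambda>u. (u, c u)) ` pverts G \<subseteq> ?R"
        by blast
      have R: "?R \<subseteq> pverts G \<times> pverts H"
        by (auto simp: resolving_set_def pverts_cartesian_product)
      have "1 \<le> s / m"
        using m by simp
      also have "s / m = (\<Sum>z \<in> (\<lambda>u. (u, c u)) ` pverts G. f z)"
        by (simp add: s_def f_def sum.reindex inj_on_def sum_divide_distrib)
      also have "\<dots> \<le> (\<Sum>z \<in> ?R. f z)"
      proof (rule sum_mono2[OF _ sub])
        show "finite ?R"
          using finite_subset[OF R] G.pair_finite_verts H.pair_finite_verts by blast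
        show "0 \<le> f z" if "z \<in> ?R - (\<lambda>u. (u, c u)) ` pverts G" for z
          using that R f01 by blast
      qed
      finally show ?thesis .
    qed
    then have "resolving_function (G \<box> H) f"
      using f01 by (auto simp: resolving_function_def pverts_cartesian_product)
    from frac_metric_dim_le[OF P this] have "frac_metric_dim (G \<box> H) \<le> s * n / m"
      by (simp add: pverts_cartesian_product times s_def)
    \<comment> \<open>The product of two numbers is their minimum times their maximum.\<close>
    also have "s * n / m = max s n"
      using m by (auto simp: m_def min_def max_def field_simps)
    finally show ?thesis
      by (simp add: dim s_def n_def)
  qed
qed

end
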